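(* Let $Z$ be an elliptic genus with data $h,\mathcal{D},\delta$, $\hat c=\mathcal{D}-2\delta/h$ (in the sense of the context), with twisted Witten indices expanded as $\mathfrak{X}_v=\sum_{d\mid h}u_d(\Delta_d)_v$, $u_d\in\mathbb{Z}$. Let $Z^{\rm orb}=\frac1h\sum_{v\in(\mathbb{Z}/h\mathbb{Z})^2}Z_v$ be the orbifold elliptic genus, $Z^{\rm orb}_v$ its twisted versions, and $\mathfrak{X}^{\rm orb}_v:=Z^{\rm orb}_v(\tau,0)$. Then $\mathfrak{X}^{\rm orb}_v$ is independent of $\tau$ and $$\mathfrak{X}^{\rm orb}_v=\sum_{d\mid h}u_{h/d}\,\gcd(\delta,d)\,\bigl(\Delta_{d/\gcd(\delta,d)}\bigr)_v\qquad\text{for all }v\in\mathbb{Z}^2 .$$ In particular $\mathfrak{X}^{\rm orb}_v\in\mathbb{Z}$ and $\mathfrak{X}^{\rm orb}_{(0,0)}=\sum_{d\mid h}u_{h/d}\,d$.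
   Context: Notation: $\mathbf{e}[x]=\exp(2\pi\sqrt{-1}\,x)$; $\mathbb{H}$ is the upper half-plane; $q^a=\mathbf{e}[a\tau]$, $y^a=\mathbf{e}[az]$ for $a\in\mathbb{Q}$; $\gcd(0,d)=d$. Data: a positive integer $h$ and integers $\mathcal{D},\delta$ such that $\hat c=\mathcal{D}-2\delta/h\ge 0$. An elliptic genus with these data is a holomorphic function $Z$ on $\mathbb{H}\times\mathbb{C}$ with the following properties. (a) $Z(\tau,z)=\sum_{n\ge0}\mathfrak{Z}_n(z)q^n$ with $\mathfrak{Z}_n(z)\in y^{-\hat c/2}\,\mathbb{Z}[y^{1/h},y^{-1/h}]$, and $\mathfrak{Z}_0(z)=y^{-\hat c/2}\chi_y$ with $\chi_y\in\mathbb{Z}[y^{1/h}]$. (b) $Z\left(\frac{a\tau+b}{c\tau+d},\frac{z}{c\tau+d}\right)=\mathbf{e}\left[\frac{\hat c}{2}\frac{cz^2}{c\tau+d}\right]Z(\tau,z)$ for all $\begin{pmatrix}a&b\\c&d\end{pmatrix}\in \mathrm{SL}_2(\mathbb{Z})$. (c) $Z(\tau,z+r\tau+s)=(-1)^{\hat c(r+s)}\,\mathbf{e}\left[-\frac{\hat c}{2}(r^2\tau+2rz)\right]Z(\tau,z)$ for all $(r,s)\in(h\mathbb{Z})^2$ (note $\hat c h\in\mathbb{Z}$). Twisting: for a holomorphic function $\phi$ on $\mathbb{H}\times\mathbb{C}$ and $v=(r,s)\in\mathbb{Z}^2$ put $$\phi_{(r,s)}(\tau,z)=(-1)^{\mathcal{D}(r+s+rs)}\,\mathbf{e}\left[\tfrac{\hat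 c}{2}(r^2\tau+2rz+rs)\right]\phi(\tau,z+r\tau+s).$$ This defines $Z_v$ (with $\phi=Z$) and $Z^{\rm orb}_v$ (with $\phi=Z^{\rm orb}$). $Z_v$ depends only on $v$ modulo $(h\mathbb{Z})^2$, so the sum defining $Z^{\rm orb}$ makes sense. (d) Standing assumption: for every $v\in\mathbb{Z}^2$, $\mathfrak{X}_v:=Z_v(\tau,0)$ is independent of $\tau$ (the twisted Witten index). For a positive integer $d$ and $v=(r,s)\in\mathbb{Z}^2$: $(\Delta_d)_v=d$ if $d\mid r$ and $d\mid s$, and $(\Delta_d)_v=0$ otherwise. For every holomorphic function $Z$ on $\mathbb{H}\times\mathbb{C}$ that has the Fourier expansion (a), the modular transformation law (b) and the quasi-periodicity (c), and whose twisted Witten indices $\mathfrak{X}_v=Z_v(\tau,0)$ are independent of $\tau$ as in (d), there are unique integers $u_d$ ($d\mid h$) with $\mathfrak{X}_v=\sum_{d\mid h}u_d(\Delta_d)_v$ for all $v\in\mathbb{Z}^2$. *)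

theory Defs
  imports "HOL-Analysis.Analysis" "HOL-Computational_Algebra.Polynomial"
begin

definition ee :: "complex \<Rightarrow> complex" where
  "ee x = exp (2 * of_real pi * \<i> * x)"

definition upper_half_plane :: "complex set" where
  "upper_half_plane = {\<tau>. Im \<tau> > 0}"

definition chat :: "nat \<Rightarrow> int \<Rightarrow> int \<Rightarrow> real" where
  "chat h D \<delta> = of_int D - 2 * of_int \<delta> / of_nat h"

(* Holomorphy in two variables: complex differentiability, i.e. a Frechet derivative
   that is complex linear. *)
definition holomorphic2_on :: "(complex \<times> complex \<Rightarrow> complex) \<Rightarrow> (complex \<times> complex) set \<Rightarrow> bool" where
  "holomorphic2_on f S \<longleftrightarrow>
     (\<forall>p\<in>S. \<exists>a b. (f has_derivative (\<lambda>(t, w). a * t + b * w)) (at p within S))"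

(* The functions of z belonging to Z[y^(1/h), y^(-1/h)], where y^a = ee (a z). *)
definition laurent_poly_fun :: "nat \<Rightarrow> (complex \<Rightarrow> complex) \<Rightarrow> bool" where
  "laurent_poly_fun h f \<longleftrightarrow>
     (\<exists>c :: int \<Rightarrow> int. finite {k. c k \<noteq> 0} \<and>
        (\<forall>z. f z = (\<Sum>k | c k \<noteq> 0. of_int (c k) * ee (of_int k / of_nat h * z))))"

(* The functions of z belonging to Z[y^(1/h)]. *)
definition poly_fun :: "nat \<Rightarrow> (complex \<Rightarrow> complex) \<Rightarrow> bool" where
  "poly_fun h f \<longleftrightarrow>
     (\<exists>p :: int poly. \<forall>z. f z = poly (map_poly of_int p) (ee (z / of_nat h)))"

definition fourier_expansion :: "nat \<Rightarrow> int \<Rightarrow> int \<Rightarrow> (complex \<Rightarrow> complex \<Rightarrow> complex) \<Rightarrow> bool" where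
  "fourier_expansion h D \<delta> Z \<longleftrightarrow>
     (\<exists>Zn :: nat \<Rightarrow> complex \<Rightarrow> complex.
        (\<forall>\<tau>\<in>upper_half_plane. \<forall>z. (\<lambda>n. Zn n z * ee (of_nat n * \<tau>)) sums Z \<tau> z) \<and>
        (\<forall>n. \<exists>f. laurent_poly_fun h f \<and>
           (\<forall>z. Zn n z = ee (- of_real (chat h D \<delta>) / 2 * z) * f z)) \<and>
        (\<exists>X. poly_fun h X \<and>
           (\<forall>z. Zn 0 z = ee (- of_real (chat h D \<delta>) / 2 * z) * X z)))"

definition modular_law :: "nat \<Rightarrow> int \<Rightarrow> int \<Rightarrow> (complex \<Rightarrow> complex \<Rightarrow> complex) \<Rightarrow> bool" where
  "modular_law h D \<delta> Z \<longleftrightarrow>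
     (\<forall>a b c d :: int. a * d - b * c = 1 \<longrightarrow>
        (\<forall>\<tau>\<in>upper_half_plane. \<forall>z.
           Z ((of_int a * \<tau> + of_int b) / (of_int c * \<tau> + of_int d)) (z / (of_int c * \<tau> + of_int d))
           = ee (of_real (chat h D \<delta>) / 2 * (of_int c * z\<^sup>2 / (of_int c * \<tau> + of_int d))) * Z \<tau> z))"

(* The real number under the floor is an integer, because chat * h is. *)
definition quasi_periodic :: "nat \<Rightarrow> int \<Rightarrow> int \<Rightarrow> (complex \<Rightarrow> complex \<Rightarrow> complex) \<Rightarrow> bool" where
  "quasi_periodic h D \<delta> Z \<longleftrightarrow>
     (\<forall>r s :: int. int h dvd r \<longrightarrow> int h dvd s \<longrightarrow>
        (\<forall>\<tau>\<in>upper_half_plane. \<forall>z.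
           Z \<tau> (z + of_int r * \<tau> + of_int s)
           = (-1) powi \<lfloor>chat h D \<delta> * of_int (r + s)\<rfloor>
             * ee (- of_real (chat h D \<delta>) / 2 * ((of_int r)\<^sup>2 * \<tau> + 2 * of_int r * z)) * Z \<tau> z))"

(* The values Z \<tau> z with \<tau> outside the upper half-plane are irrelevant. *)
definition elliptic_genus :: "nat \<Rightarrow> int \<Rightarrow> int \<Rightarrow> (complex \<Rightarrow> complex \<Rightarrow> complex) \<Rightarrow> bool" where
  "elliptic_genus h D \<delta> Z \<longleftrightarrow>
     h > 0 \<and> chat h D \<delta> \<ge> 0 \<and>
     holomorphic2_on (\<lambda>(\<tau>, z). Z \<tau> z) (upper_half_plane \<times> UNIV) \<and>
     fourier_expansion h D \<delta> Z \<and> modular_law h D \<delta> Z \<and> quasi_periodic h D \<delta> Z"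

definition twist ::
    "nat \<Rightarrow> int \<Rightarrow> int \<Rightarrow> (complex \<Rightarrow> complex \<Rightarrow> complex) \<Rightarrow> int \<Rightarrow> int \<Rightarrow> complex \<Rightarrow> complex \<Rightarrow> complex" where
  "twist h D \<delta> \<phi> r s \<tau> z =
     (-1) powi (D * (r + s + r * s))
     * ee (of_real (chat h D \<delta>) / 2 * ((of_int r)\<^sup>2 * \<tau> + 2 * of_int r * z + of_int (r * s)))
     * \<phi> \<tau> (z + of_int r * \<tau> + of_int s)"

definition witten_index ::
    "nat \<Rightarrow> int \<Rightarrow> int \<Rightarrow> (complex \<Rightarrow> complex \<Rightarrow> complex) \<Rightarrow> int \<Rightarrow> int \<Rightarrow> complex \<Rightarrow> complex" where
  "witten_index h D \<delta> \<phi> r s \<tau> = twist h D \<delta> \<phi> r s \<tau> 0"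

(* (Z/hZ)^2 is represented by {0..<h}^2; twist_cong below shows that the choice of
   representatives does not matter. *)
definition orbifold :: "nat \<Rightarrow> int \<Rightarrow> int \<Rightarrow> (complex \<Rightarrow> complex \<Rightarrow> complex) \<Rightarrow> complex \<Rightarrow> complex \<Rightarrow> complex" where
  "orbifold h D \<delta> Z \<tau> z =
     1 / of_nat h * (\<Sum>(r, s) \<in> {0..<int h} \<times> {0..<int h}. twist h D \<delta> Z r s \<tau> z)"

definition Delta :: "int \<Rightarrow> int \<Rightarrow> int \<Rightarrow> int" where
  "Delta d r s = (if d dvd r \<and> d dvd s then d else 0)"

lemma ee_add: "ee (x + y) = ee x * ee y"
  by (simp add: ee_def ring_distribs exp_add)

lemma ee_of_int: "ee (of_int n) = 1"
  unfolding ee_def using exp_integer_2pi[of "of_int n"] by (simp add: mult_ac)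

lemma ee_half_int: "ee (of_int n / 2) = (-1) powi n"
proof (cases "even n")
  case True
  then obtain k where "n = 2 * k" by blast
  then show ?thesis using ee_of_int[of k] by (simp add: power_int_mult)
next
  case False
  then obtain k where k: "n = 2 * k + 1" using oddE by blast
  have "ee (of_int n / 2) = ee (of_int k) * ee (1/2)"
    by (subst ee_add[symmetric]) (simp add: k add_divide_distrib)
  also have "ee (1/2) = -1" by (simp add: ee_def)
  finally show ?thesis using False by (simp add: ee_of_int power_int_minus_left)
qed

lemma twist_cong:
  assumes h: "h > 0" and qp: "quasi_periodic h D \<delta> Z" and \<tau>: "\<tau> \<in> upper_half_plane"
    and r: "r mod int h = r' mod int h" and s: "s mod int h = s' mod int h"
  shows "twist h D \<delta> Z r s \<tau> z = twist h D \<delta> Z r' s' \<tau> z"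
proof -
  define m where "m = (r' - r) div int h"
  define n where "n = (s' - s) div int h"
  have r': "r' = r + int h * m" and s': "s' = s + int h * n"
    using mod_eq_dvd_iff[of r' "int h" r] mod_eq_dvd_iff[of s' "int h" s] r s by (simp_all add: m_def n_def)
  define K :: complex where "K = of_real (chat h D \<delta>) / 2"
  define R :: complex where "R = of_int r"
  define S :: complex where "S = of_int s"
  define R' :: complex where "R' = of_int (int h * m)"
  define S' :: complex where "S' = of_int (int h * n)"
  have chat: "chat h D \<delta> * of_int (int h * k) = of_int ((D * int h - 2 * \<delta>) * k)" for k
    using h by (simp add: chat_def field_simps)
  have KR: "2 * K * R' = of_int ((D * int h - 2 * \<delta>) * m)" and KS: "2 * K * S' = of_int ((D * int h - 2 * \<delta>) * n)"
    using arg_cong[OF chat[of m], of complex_of_real] arg_cong[OF chat[of n], of complex_of_real]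
    by (simp_all add: K_def R'_def S'_def)
  define N where "N = (D * int h - 2 * \<delta>) * (m + n)"
  have fl: "\<lfloor>chat h D \<delta> * of_int (int h * m + int h * n)\<rfloor> = N"
    using chat[of "m + n"] by (simp add: N_def ring_distribs del: of_int_mult of_int_add of_int_diff)
  define w where "w = z + R * \<tau> + S"
  have Zw: "Z \<tau> (w + R' * \<tau> + S') = (-1) powi N * ee (- K * (R'\<^sup>2 * \<tau> + 2 * R' * w)) * Z \<tau> w"
    using qp \<tau> unfolding quasi_periodic_def R'_def S'_def
    by (auto simp del: of_int_mult of_int_add simp add: fl K_def)
  define E1 where "E1 = K * ((R + R')\<^sup>2 * \<tau> + 2 * (R + R') * z + (R + R') * (S + S'))"
  have eqs: "of_int r' = R + R'" "of_int s' = S + S'" and arg: "z + (R + R') * \<tau> + (S + S') = w + R' * \<tau> + S'"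
    by (simp_all add: r' s' R_def S_def R'_def S'_def w_def algebra_simps)
  have "twist h D \<delta> Z r' s' \<tau> z =
     ee (of_int (D * (r' + s' + r' * s')) / 2) * ee E1 * Z \<tau> (w + R' * \<tau> + S')"
    unfolding twist_def ee_half_int of_int_mult[of r' s'] eqs arg[symmetric] E1_def K_def
    by (simp add: eqs add.assoc)
  also have "\<dots> =
     ee (of_int (D * (r' + s' + r' * s')) / 2 + E1 + of_int N / 2 + - K * (R'\<^sup>2 * \<tau> + 2 * R' * w)) * Z \<tau> w"
    unfolding Zw ee_add ee_half_int by simp
  also have "of_int (D * (r' + s' + r' * s')) / 2 + E1 + of_int N / 2 + - K * (R'\<^sup>2 * \<tau> + 2 * R' * w)
     = of_int (D * (r + s + r * s)) / 2 + K * (R\<^sup>2 * \<tau> + 2 * R * z + R * S)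
      + (of_int (D * (r' + s' + r' * s') - D * (r + s + r * s)) / 2 + of_int N / 2
        + ((2 * K * S') * R - (2 * K * R') * S + (2 * K * R') * S') / 2)"
    by (simp add: E1_def w_def field_simps power2_eq_square)
  also have "of_int (D * (r' + s' + r' * s') - D * (r + s + r * s)) / 2 + of_int N / 2
        + ((2 * K * S') * R - (2 * K * R') * S + (2 * K * R') * S') / 2
     = (of_int (D * int h * (m + n + r * n + int h * m * n) - \<delta> * (m + n + n * r - m * s + m * n * int h)) :: complex)"
    unfolding KR KS by (simp add: r' s' R_def S_def S'_def N_def field_simps)
  finally show ?thesis
    unfolding ee_add ee_of_int
    by (simp add: twist_def ee_half_int[symmetric] K_def R_def S_def w_def)
qed

end

(* (Z_w)_v equals Z_(v + w) up to the phase e[delta omega(v, w) / h], with omega the standard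
   symplectic form, so X^orb_v is a finite symplectic Fourier transform of X over (Z/hZ)^2.
   For d dvd h it takes Delta_d to h/d times the indicator of the condition (h/d) dvd delta v, and this
   condition says that v is divisible by (h/d) / gcd(delta, h/d). *)
theory Submission
  imports Defs
begin

text \<open>Sign and exponential merge into one factor \<open>ee (A r s w)\<close>, so composing
  twists adds exponents. Compared with the exponent of the sum vector, the signs leave the cross
  term -D(rs' + sr')/2 and the quadratic part leaves K(sr' - rs').\<close>

lemma twist_twist:
  assumes "h > 0"
  shows "twist h D \<delta> (twist h D \<delta> \<phi> r' s') r s \<tau> z
     = ee (of_int (\<delta> * (r * s' - s * r')) / of_nat h) * twist h D \<delta> \<phi> (r + r') (s + s') \<tau> z"
proof -
  define K :: complex where "K = of_real (chat h D \<delta>) / 2"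
  define A where "A r s w = of_int (D * (r + s + r * s)) / 2
      + K * ((of_int r)\<^sup>2 * \<tau> + 2 * of_int r * w + of_int (r * s))" for r s w
  have tw: "twist h D \<delta> \<psi> r s \<tau> w = ee (A r s w) * \<psi> \<tau> (w + of_int r * \<tau> + of_int s)" for \<psi> r s w
    unfolding twist_def A_def ee_add K_def ee_half_int ..
  have K: "K = of_int D / 2 - of_int \<delta> / of_nat h"
    by (simp add: K_def chat_def field_simps)
  \<comment> \<open>Since K = D/2 - \<delta>/h, the D-parts of the cross terms add up to the integer
    -D r s', which \<open>ee\<close> does not see; only the \<delta>-part survives, as the
    symplectic phase.\<close>
  have "A r s z + A r' s' (z + of_int r * \<tau> + of_int s)
      = of_int (\<delta> * (r * s' - s * r')) / of_nat h + A (r + r') (s + s') z + of_int (- D * r * s')"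
    using assms unfolding A_def K by (simp add: field_simps power2_eq_square)
  then have "ee (A r s z) * ee (A r' s' (z + of_int r * \<tau> + of_int s))
      = ee (of_int (\<delta> * (r * s' - s * r')) / of_nat h) * ee (A (r + r') (s + s') z)"
    unfolding ee_add[symmetric] by (simp only: ee_add ee_of_int mult_1_right)
  moreover have "z + of_int r * \<tau> + of_int s + of_int r' * \<tau> + of_int s'
      = z + of_int (r + r') * \<tau> + of_int (s + s')"
    by (simp add: algebra_simps)
  ultimately show ?thesis
    by (simp only: tw mult.assoc[symmetric])
qed

lemma ee_eq_1_iff: "ee x = 1 \<longleftrightarrow> x \<in> \<int>"
proof
  assume "ee x = 1"
  then obtain n :: int where "Re (2 * of_real pi * \<i> * x) = 0"
    and n: "Im (2 * of_real pi * \<i> * x) = of_int (2 * n) * pi"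
    by (auto simp: ee_def exp_eq_1)
  then have "x = of_int n"
    by (simp add: complex_eq_iff)
  then show "x \<in> \<int>" by simp
qed (auto simp: ee_of_int elim!: Ints_cases)

lemma ee_power: "ee x ^ n = ee (of_nat n * x)"
  by (simp add: ee_def exp_of_nat_mult[symmetric] mult_ac)

lemma of_int_divide_in_Ints_iff:
  assumes "m > 0"
  shows "(of_int k / of_nat m :: complex) \<in> \<int> \<longleftrightarrow> int m dvd k"
proof
  assume "(of_int k / of_nat m :: complex) \<in> \<int>"
  then obtain n where "(of_int k / of_nat m :: complex) = of_int n"
    by (auto elim: Ints_cases)
  then have "(of_int k :: complex) = of_int (n * int m)"
    using assms by (simp add: field_simps)
  then show "int m dvd k"
    unfolding of_int_eq_iff by simp
next
  assume "int m dvd k"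
  then show "(of_int k / of_nat m :: complex) \<in> \<int>"
    using assms by (auto elim!: dvdE)
qed

text \<open>Geometric series whose ratio is an m-th root of unity, equal to 1 exactly when m divides
  k.\<close>

lemma sum_roots_of_unity:
  assumes "m > 0"
  shows "(\<Sum>j<m. ee (of_int k / of_nat m) ^ j) = (if int m dvd k then of_nat m else 0)"
proof (cases "int m dvd k")
  case True
  then have "ee (of_int k / of_nat m) = 1"
    using assms by (simp add: ee_eq_1_iff of_int_divide_in_Ints_iff)
  with True show ?thesis by simp
next
  case False
  then have "ee (of_int k / of_nat m) \<noteq> 1"
    using assms by (simp add: ee_eq_1_iff of_int_divide_in_Ints_iff)
  moreover have "ee (of_int k / of_nat m) ^ m = 1"
    using assms ee_of_int[of k] by (simp add: ee_power)
  ultimately show ?thesis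
    using False by (simp add: geometric_sum)
qed

text \<open>The sum runs over the coset -a + dZ modulo h, a translate of a subgroup of order h/d. A
  character of Z/hZ sums to zero there unless it is trivial on that subgroup, that is, unless h/d
  divides k; then it is constant on the coset, with its value at -a.\<close>

lemma sum_character_coset:
  assumes h: "h > 0" and d: "d dvd h"
  shows "(\<Sum>x\<in>{0..<int h}. if int d dvd a + x then ee (of_int (k * x) / of_nat h) else 0)
    = (if int (h div d) dvd k then of_nat (h div d) * ee (- of_int (k * a) / of_nat h) else 0)"
proof -
  define m where "m = h div d"
  have hm: "h = d * m" and m: "m > 0" and d0: "d > 0"
    using assms by (auto simp: m_def elim!: dvdE)
  \<comment> \<open>Least nonnegative element of the coset; the coset meets [0, h) exactly in the
    points b + dj with 0 \<le> j < m.\<close>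
  define b where "b = (- a) mod int d"
  have b: "0 \<le> b" "b < int d"
    using d0 by (simp_all add: b_def)
  obtain t where t: "b = - a + int d * t"
    using mult_div_mod_eq[of "int d" "- a"] by (metis b_def add_diff_cancel_left' diff_conv_add_uminus mult_minus_right)
  have set: "{x \<in> {0..<int h}. int d dvd a + x} = (\<lambda>j. b + int d * int j) ` {..<m}"
  proof (intro subset_antisym subsetI)
    fix x assume x: "x \<in> {x \<in> {0..<int h}. int d dvd a + x}"
    have "a + x = (x - b) + int d * t" by (simp add: t)
    with x have "int d dvd x - b" by (metis (lifting) dvd_add_times_triv_right_iff mem_Collect_eq mult.commute)
    then obtain j where j: "x = b + int d * j"
      by (metis dvdE add.commute diff_add_cancel)
    \<comment> \<open>From x \<ge> 0 and b < d one gets dj > -d, which rules out negative j.\<close>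
    have "int d * (j + 1) > 0" using x b j by (simp add: algebra_simps)
    then have "0 \<le> j" using d0 by (simp add: zero_less_mult_iff)
    have "x < int d * int m" using x by (simp add: hm)
    then have "int d * j < int d * int m" using b j by linarith
    then have "j < int m" using d0 by simp
    with \<open>0 \<le> j\<close> show "x \<in> (\<lambda>j. b + int d * int j) ` {..<m}"
      by (intro image_eqI[of _ _ "nat j"]) (auto simp: j)
  next
    fix x assume "x \<in> (\<lambda>j. b + int d * int j) ` {..<m}"
    then obtain j where j: "j < m" "x = b + int d * int j" by auto
    have "int d * (int j + 1) \<le> int d * int m"
      using j by (intro mult_left_mono) auto
    then have "x < int h" using b by (simp add: j hm algebra_simps)
    moreover have "a + x = int d * (t + int j)" by (simp add: j t algebra_simps)
    ultimately show "x \<in> {x \<in> {0..<int h}. int d dvd a + x}"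
      using b by (simp add: j)
  qed
  have inj: "inj_on (\<lambda>j. b + int d * int j) {..<m}"
    using d0 by (auto simp: inj_on_def)
  have "(\<Sum>x\<in>{0..<int h}. if int d dvd a + x then ee (of_int (k * x) / of_nat h) else 0)
      = (\<Sum>x\<in>{x \<in> {0..<int h}. int d dvd a + x}. ee (of_int (k * x) / of_nat h))"
    by (rule sum.inter_filter[symmetric]) simp
  also have "\<dots> = (\<Sum>j<m. ee (of_int (k * (b + int d * int j)) / of_nat h))"
    unfolding set by (simp only: sum.reindex[OF inj] o_def)
  \<comment> \<open>As h = dm, a step of length d in x multiplies the character by
    \<open>ee (k / m)\<close>.\<close>
  also have "\<dots> = (\<Sum>j<m. ee (of_int (k * b) / of_nat h) * ee (of_int k / of_nat m) ^ j)"
    unfolding ee_power ee_add[symmetric] using m d0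
    by (intro sum.cong refl arg_cong[of _ _ ee]) (simp add: hm field_simps)
  also have "\<dots> = ee (of_int (k * b) / of_nat h) * (if int m dvd k then of_nat m else 0)"
    by (simp only: sum_distrib_left[symmetric] sum_roots_of_unity[OF m])
  also have "\<dots> = (if int m dvd k then of_nat m * ee (- of_int (k * a) / of_nat h) else 0)"
  proof (cases "int m dvd k")
    case True
    then obtain l where "k = int m * l" by (auto elim: dvdE)
    \<comment> \<open>Replacing the representative b by -a changes the exponent by the integer lt
      only.\<close>
    then have "(of_int (k * b) / of_nat h :: complex) = - of_int (k * a) / of_nat h + of_int (l * t)"
      using m d0 by (simp add: t hm field_simps)
    with True show ?thesis by (simp only: ee_add ee_of_int) simp
  qed simp
  finally show ?thesis by (simp add: m_def)
qed

text \<open>Both the phase and the Delta function factor into a part in r' and a part in s', so the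
  double sum is d times a product of two coset sums. When both are nonzero each contributes h/d up
  to a phase, and d(h/d)^2 = h(h/d).\<close>

lemma symplectic_sum_Delta:
  assumes h: "h > 0" and d: "d dvd h"
  shows "(\<Sum>(r', s')\<in>{0..<int h} \<times> {0..<int h}.
            ee (of_int (\<delta> * (r * s' - s * r')) / of_nat h) * of_int (Delta (int d) (r + r') (s + s')))
    = (if int (h div d) dvd \<delta> * r \<and> int (h div d) dvd \<delta> * s then of_nat h * of_nat (h div d) else 0)"
    (is "?lhs = ?rhs")
proof -
  define F :: "int \<Rightarrow> int \<Rightarrow> int \<Rightarrow> complex"
    where "F a k x = (if int d dvd a + x then ee (of_int (k * x) / of_nat h) else 0)" for a k x
  have split: "ee (of_int (\<delta> * (r * s' - s * r')) / of_nat h) * of_int (Delta (int d) (r + r') (s + s'))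
      = of_nat d * (F r (- \<delta> * s) r' * F s (\<delta> * r) s')" for r' s'
  proof -
    have "(of_int (\<delta> * (r * s' - s * r')) / of_nat h :: complex)
        = of_int (- \<delta> * s * r') / of_nat h + of_int (\<delta> * r * s') / of_nat h"
      using h by (simp add: field_simps)
    then have "ee (of_int (\<delta> * (r * s' - s * r')) / of_nat h)
        = ee (of_int (- \<delta> * s * r') / of_nat h) * ee (of_int (\<delta> * r * s') / of_nat h)"
      by (simp only: ee_add)
    then show ?thesis by (simp add: F_def Delta_def)
  qed
  have "?lhs = of_nat d * (\<Sum>(r', s')\<in>{0..<int h} \<times> {0..<int h}. F r (- \<delta> * s) r' * F s (\<delta> * r) s')"
    by (simp only: split sum_distrib_left[symmetric] case_prod_unfold)
  also have "\<dots> = of_nat d * ((\<Sum>x\<in>{0..<int h}. F r (- \<delta> * s) x) * (\<Sum>x\<in>{0..<int h}. F s (\<delta> * r) x))"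
    by (simp only: sum_product sum.cartesian_product)
  also have "\<dots> = ?rhs"
  proof (cases "int (h div d) dvd \<delta> * r \<and> int (h div d) dvd \<delta> * s")
    case True
    \<comment> \<open>The two coset phases together are the symplectic phase of (r, s) against (-r,
      -s), which is trivial because the form is alternating.\<close>
    have "ee (- of_int (- \<delta> * s * r) / of_nat h) * ee (- of_int (\<delta> * r * s) / of_nat h) = 1"
      unfolding ee_add[symmetric] by (simp add: ee_def)
    moreover have "(of_nat h :: complex) = of_nat d * of_nat (h div d)"
      using d by (simp flip: of_nat_mult)
    ultimately show ?thesis
      using True unfolding F_def sum_character_coset[OF h d] by simp
  next
    case False
    then show ?thesis unfolding F_def sum_character_coset[OF h d] by auto
  qed
  finally show ?thesis .
qed

text \<open>With g the gcd, \<delta>/g and d/g are coprime, so d divides \<delta>x exactly when d/g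
  divides x; the values agree because g(d/g) = d.\<close>

lemma gcd_mult_Delta_div_gcd:
  assumes "d > 0"
  shows "gcd \<delta> d * Delta (d div gcd \<delta> d) r s = (if d dvd \<delta> * r \<and> d dvd \<delta> * s then d else 0)"
proof -
  define g where "g = gcd \<delta> d"
  have g: "g > 0" using assms by (simp add: g_def)
  have d: "d = g * (d div g)" and \<delta>: "\<delta> = g * (\<delta> div g)"
    by (simp_all add: g_def)
  have "coprime (d div g) (\<delta> div g)"
    using assms unfolding g_def by (metis div_gcd_coprime coprime_commute less_irrefl)
  then have "d dvd \<delta> * x \<longleftrightarrow> d div g dvd x" for x
    using g by (subst d, subst \<delta>) (simp add: mult.assoc coprime_dvd_mult_right_iff)
  then show ?thesis
    using d by (simp add: Delta_def g_def[symmetric])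
qed

text \<open>Stated at a single \<tau>: the right-hand side does not contain \<tau>, so constancy of
  the orbifold index follows from the formula itself.\<close>

lemma orbifold_witten_index:
  assumes h: "h > 0"
    and index: "\<And>r s. witten_index h D \<delta> Z r s \<tau> = of_int (\<Sum>d | d dvd h. u d * Delta (int d) r s)"
  shows "witten_index h D \<delta> (orbifold h D \<delta> Z) r s \<tau>
    = of_int (\<Sum>d | d dvd h. u (h div d) * gcd \<delta> (int d) * Delta (int d div gcd \<delta> (int d)) r s)"
proof -
  define P where "P r' s' = ee (of_int (\<delta> * (r * s' - s * r')) / of_nat h)" for r' s'
  define I where "I = {0..<int h} \<times> {0..<int h}"
  have "witten_index h D \<delta> (orbifold h D \<delta> Z) r s \<tau>
      = 1 / of_nat h * (\<Sum>(r', s')\<in>I. twist h D \<delta> (twist h D \<delta> Z r' s') r s \<tau> 0)"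
    \<comment> \<open>Only the outer twists are unfolded: twisting is linear in the function, so it
      passes through the orbifold sum while each inner twist of \<open>Z\<close> stays
      intact.\<close>
    unfolding witten_index_def I_def twist_def[of h D \<delta> "orbifold h D \<delta> Z"]
      twist_def[of h D \<delta> "twist h D \<delta> Z _ _"] orbifold_def
    by (simp add: sum_distrib_left case_prod_unfold mult_ac)
  also have "\<dots> = 1 / of_nat h * (\<Sum>(r', s')\<in>I. \<Sum>d | d dvd h.
      of_int (u d) * (P r' s' * of_int (Delta (int d) (r + r') (s + s'))))"
    unfolding twist_twist[OF h] index[unfolded witten_index_def] P_def
    by (simp add: sum_distrib_left mult_ac)
  also have "\<dots> = 1 / of_nat h * (\<Sum>d | d dvd h. of_int (u d) *
      (\<Sum>(r', s')\<in>I. P r' s' * of_int (Delta (int d) (r + r') (s + s'))))"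
    unfolding case_prod_unfold by (subst sum.swap) (simp add: sum_distrib_left)
  \<comment> \<open>The prefactor 1/h of the orbifold cancels the factor h of the symplectic
    sum.\<close>
  also have "\<dots> = (\<Sum>d | d dvd h. of_int (u d *
      (if int (h div d) dvd \<delta> * r \<and> int (h div d) dvd \<delta> * s then int (h div d) else 0)))"
    unfolding sum_distrib_left[of "1 / of_nat h"] I_def P_def of_int_sum
    by (intro sum.cong refl, subst symplectic_sum_Delta) (use h in auto)
  also have "\<dots> = (\<Sum>d | d dvd h. of_int (u (h div d) *
      (if int d dvd \<delta> * r \<and> int d dvd \<delta> * s then int d else 0)))"
    \<comment> \<open>The involution d -> h/d on the divisors of h moves the quotient from the
      divisibility condition to the index of \<open>u\<close>.\<close>
    by (rule sum.reindex_bij_witness[of _ "\<lambda>d. h div d" "\<lambda>d. h div d"]) (use h in auto)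
  also have "\<dots> = of_int (\<Sum>d | d dvd h.
      u (h div d) * gcd \<delta> (int d) * Delta (int d div gcd \<delta> (int d)) r s)"
    unfolding of_int_sum
  proof (intro sum.cong refl arg_cong[of _ _ of_int])
    fix d assume "d \<in> {d. d dvd h}"
    then have "int d > 0" using h by (auto intro: Nat.gr0I)
    from gcd_mult_Delta_div_gcd[OF this, of \<delta> r s]
    show "u (h div d) * (if int d dvd \<delta> * r \<and> int d dvd \<delta> * s then int d else 0)
        = u (h div d) * gcd \<delta> (int d) * Delta (int d div gcd \<delta> (int d)) r s"
      by (simp only: mult.assoc)
  qed
  finally show ?thesis .
qed

theorem mainTheorem4:
  fixes h :: nat and D \<delta> :: int and Z :: "complex \<Rightarrow> complex \<Rightarrow> complex" and u :: "nat \<Rightarrow> int"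
  assumes "elliptic_genus h D \<delta> Z"
    and "\<And>r s. witten_index h D \<delta> Z r s constant_on upper_half_plane"
    and "\<And>r s \<tau>. \<tau> \<in> upper_half_plane \<Longrightarrow>
           witten_index h D \<delta> Z r s \<tau> = of_int (\<Sum>d | d dvd h. u d * Delta (int d) r s)"
  shows "(\<forall>r s. witten_index h D \<delta> (orbifold h D \<delta> Z) r s constant_on upper_half_plane) \<and>
         (\<forall>r s. \<forall>\<tau>\<in>upper_half_plane.
            witten_index h D \<delta> (orbifold h D \<delta> Z) r s \<tau>
            = of_int (\<Sum>d | d dvd h. u (h div d) * gcd \<delta> (int d)
                                     * Delta (int d div gcd \<delta> (int d)) r s)) \<and>
         (\<forall>r s. \<forall>\<tau>\<in>upper_half_plane. witten_index h D \<delta> (orbifold h D \<delta> Z) r s \<tau> \<in> \<int>) \<and>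
         (\<forall>\<tau>\<in>upper_half_plane.
            witten_index h D \<delta> (orbifold h D \<delta> Z) 0 0 \<tau>
            = of_int (\<Sum>d | d dvd h. u (h div d) * int d))"
proof -
  have h: "h > 0" using assms(1) by (simp add: elliptic_genus_def)
  have index: "witten_index h D \<delta> (orbifold h D \<delta> Z) r s \<tau>
      = of_int (\<Sum>d | d dvd h. u (h div d) * gcd \<delta> (int d) * Delta (int d div gcd \<delta> (int d)) r s)"
    if "\<tau> \<in> upper_half_plane" for r s \<tau>
    using orbifold_witten_index[OF h assms(3)[OF that]] .
  have "witten_index h D \<delta> (orbifold h D \<delta> Z) r s constant_on upper_half_plane" for r s
    unfolding constant_on_def using index by blast
  \<comment> \<open>At the origin every divisibility condition holds, and the gcd times its cofactor
    gives back d.\<close>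
  moreover have "(\<Sum>d | d dvd h. u (h div d) * gcd \<delta> (int d) * Delta (int d div gcd \<delta> (int d)) 0 0)
      = (\<Sum>d | d dvd h. u (h div d) * int d)"
    by (simp add: Delta_def mult.assoc)
  ultimately show ?thesis
    by (simp add: index del: of_int_sum of_int_mult)
qed

end
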